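(* Let $\mathbf{V}$ be an extension-closed pseudovariety of finite groups. Then the following conditions are equivalent: (i) every cyclic subgroup of a free group is $\mathbf{V}$-closed (i.e. for every free group $F$, every cyclic subgroup of $F$ is $\mathbf{V}$-closed in $F$); (ii) $\mathbf{V}$ contains all finite abelian groups.
   Context: A pseudovariety of finite groups is a class of finite groups closed under taking subgroups, homomorphic images and finitary direct products. It is extension-closed if for every finite group $G$ and every $N \unlhd G$, $N \in \mathbf{V}$ and $G/N \in \mathbf{V}$ imply $G \in \mathbf{V}$. The pro-$\mathbf{V}$ topology on a group $G$ is the coarsest topology making all homomorphisms from $G$ into (discrete) members of $\mathbf{V}$ continuous; equivalently, $G$ is a topological group in which the normal subgroups $K$ with $G/K \in \mathbf{V}$ form a basis of neighbourhoods of the identity. "$\mathbf{V}$-closed" means closed in the pro-$\mathbf{V}$ topology. *)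

theory Defs
  imports "HOL-Algebra.Product_Groups" "HOL-Analysis.Abstract_Topology"
begin

section \<open>Pseudovarieties of finite groups\<close>

text \<open>
  Every finite group has an isomorphic copy whose carrier is a set of natural numbers, so a class
  of finite groups that is closed under isomorphism is represented by the set of its members of
  type \<^typ>\<open>nat monoid\<close>. A group over any other type belongs to the class if it is
  isomorphic to one of these.
\<close>

definition in_class :: "('a, 'b) monoid_scheme \<Rightarrow> nat monoid set \<Rightarrow> bool"
  where "in_class G V \<longleftrightarrow> group G \<and> (\<exists>H\<in>V. G \<cong> H)"

text \<open>
  Closure under isomorphism is the case of bijective epimorphisms. The empty index set is allowed
  in the last clause, so the trivial group always belongs to a pseudovariety.
\<close>

definition pseudovariety :: "nat monoid set \<Rightarrow> bool"
  where "pseudovariety V \<longleftrightarrow>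
    (\<forall>G\<in>V. group G \<and> finite (carrier G)) \<and>
    (\<forall>G\<in>V. \<forall>H. subgroup H G \<longrightarrow> G\<lparr>carrier := H\<rparr> \<in> V) \<and>
    (\<forall>G\<in>V. \<forall>H. group H \<and> epi G H \<noteq> {} \<longrightarrow> H \<in> V) \<and>
    (\<forall>(I :: nat set) G. finite I \<and> (\<forall>i\<in>I. G i \<in> V) \<longrightarrow> in_class (product_group I G) V)"

definition extension_closed :: "nat monoid set \<Rightarrow> bool"
  where "extension_closed V \<longleftrightarrow>
    (\<forall>(G :: nat monoid) N. group G \<and> finite (carrier G) \<and> N \<lhd> G \<and>
       in_class (G\<lparr>carrier := N\<rparr>) V \<and> in_class (G Mod N) V \<longrightarrow> G \<in> V)"

section \<open>The pro-V topology\<close>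

definition pro_topology :: "nat monoid set \<Rightarrow> ('a, 'b) monoid_scheme \<Rightarrow> 'a topology"
  where "pro_topology V G =
    topology_generated_by
      {{x \<in> carrier G. h x \<in> U} | h H U. H \<in> V \<and> h \<in> hom G H \<and> U \<subseteq> carrier H}"

lemma topspace_pro_topology:
  assumes "pseudovariety V" "group G"
  shows "topspace (pro_topology V G) = carrier G"
proof -
  have "\<forall>(I :: nat set) G. finite I \<and> (\<forall>i\<in>I. G i \<in> V) \<longrightarrow> in_class (product_group I G) V"
    using assms(1) by (simp add: pseudovariety_def)
  then have "in_class (product_group {} (\<lambda>_::nat. undefined :: nat monoid)) V"
    by (elim allE[of _ "{}"] allE[of _ "\<lambda>_. undefined"] impE) auto
  then obtain H where H: "H \<in> V" unfolding in_class_def by blast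
  interpret H: group H using assms(1) H by (simp add: pseudovariety_def)
  have "(\<lambda>_. \<one>\<^bsub>H\<^esub>) \<in> hom G H" by (auto simp: hom_def)
  then have "{x \<in> carrier G. \<one>\<^bsub>H\<^esub> \<in> carrier H} \<subseteq> topspace (pro_topology V G)"
    using H unfolding pro_topology_def topology_generated_by_topspace
    by (intro Union_upper CollectI exI[of _ "\<lambda>_. \<one>\<^bsub>H\<^esub>"] exI[of _ H] exI[of _ "carrier H"]) auto
  then have "carrier G \<subseteq> topspace (pro_topology V G)" by simp
  moreover have "topspace (pro_topology V G) \<subseteq> carrier G"
    unfolding pro_topology_def topology_generated_by_topspace by blast
  ultimately show ?thesis by blast
qed

lemma continuous_map_pro_topology:
  assumes "H \<in> V" "h \<in> hom G H"
  shows "continuous_map (pro_topology V G) (discrete_topology (carrier H)) h"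
proof -
  have top: "topspace (pro_topology V G) \<subseteq> carrier G"
    unfolding pro_topology_def topology_generated_by_topspace by blast
  have "openin (pro_topology V G) {x \<in> topspace (pro_topology V G). h x \<in> U}"
    if "U \<subseteq> carrier H" for U
  proof -
    have op: "openin (pro_topology V G) {x \<in> carrier G. h x \<in> U}"
      unfolding pro_topology_def using assms that
      by (intro topology_generated_by_Basis CollectI exI[of _ h] exI[of _ H] exI[of _ U]) auto
    moreover have "{x \<in> topspace (pro_topology V G). h x \<in> U} = {x \<in> carrier G. h x \<in> U}"
      using top openin_subset[OF op] by blast
    ultimately show ?thesis by simp
  qed
  moreover have "h \<in> topspace (pro_topology V G) \<rightarrow> carrier H"
    using top assms(2) by (auto simp: hom_def)
  ultimately show ?thesis by (auto simp: continuous_map_def)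
qed

lemma pro_topology_coarsest:
  assumes "topspace T = carrier G"
    and "\<And>H h. H \<in> V \<Longrightarrow> h \<in> hom G H \<Longrightarrow> continuous_map T (discrete_topology (carrier H)) h"
    and "openin (pro_topology V G) U"
  shows "openin T U"
proof (rule generate_topology_on_coarsest)
  show "generate_topology_on
      {{x \<in> carrier G. h x \<in> U} | h H U. H \<in> V \<and> h \<in> hom G H \<and> U \<subseteq> carrier H} U"
    using assms(3) unfolding pro_topology_def openin_topology_generated_by_iff .
  fix S assume "S \<in> {{x \<in> carrier G. h x \<in> U} | h H U. H \<in> V \<and> h \<in> hom G H \<and> U \<subseteq> carrier H}"
  then obtain h H W where "S = {x \<in> carrier G. h x \<in> W}" "H \<in> V" "h \<in> hom G H" "W \<subseteq> carrier H"
    by blast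
  then show "openin T S"
    using assms(2)[of H h] assms(1) by (auto simp: continuous_map_def)
qed simp

section \<open>Free groups\<close>

text \<open>A word in letters and their formal inverses: \<open>(x, True)\<close> stands for \<open>x\<close> and
  \<open>(x, False)\<close> for its inverse.\<close>

primrec word_eval :: "('a, 'b) monoid_scheme \<Rightarrow> ('a \<times> bool) list \<Rightarrow> 'a"
  where
    "word_eval G [] = \<one>\<^bsub>G\<^esub>"
  | "word_eval G (p # w) = (if snd p then fst p else inv\<^bsub>G\<^esub> (fst p)) \<otimes>\<^bsub>G\<^esub> word_eval G w"

definition reduced_words :: "'a set \<Rightarrow> ('a \<times> bool) list set"
  where "reduced_words X =
    {w. fst ` set w \<subseteq> X \<and> successively (\<lambda>p q. \<not> (fst p = fst q \<and> snd p \<noteq> snd q)) w}"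

text \<open>\<open>F\<close> is free on \<open>X\<close> if every element of \<open>F\<close> is the value of exactly one reduced word
  over \<open>X\<close>. The universal property is derived below. Unlike this definition, it quantifies
  over groups of all types.\<close>

definition free_on :: "('a, 'b) monoid_scheme \<Rightarrow> 'a set \<Rightarrow> bool"
  where "free_on F X \<longleftrightarrow>
    group F \<and> X \<subseteq> carrier F \<and> bij_betw (word_eval F) (reduced_words X) (carrier F)"

definition free_group :: "('a, 'b) monoid_scheme \<Rightarrow> bool"
  where "free_group F \<longleftrightarrow> (\<exists>X. free_on F X)"

text \<open>Every nontrivial free group is infinite. A statement about all free groups over a type
  \<open>'a\<close> is therefore only meaningful if \<open>'a\<close> is infinite. In that case free groups of every
  rank up to the cardinality of \<open>'a\<close> occur with carrier in \<open>'a\<close>.\<close>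

definition word_cons :: "'a \<times> bool \<Rightarrow> ('a \<times> bool) list \<Rightarrow> ('a \<times> bool) list"
  where "word_cons p w =
    (if w \<noteq> [] \<and> fst (hd w) = fst p \<and> snd (hd w) \<noteq> snd p then tl w else p # w)"

lemma word_cons_reduced:
  assumes "w \<in> reduced_words X" "fst p \<in> X"
  shows "word_cons p w \<in> reduced_words X"
  using assms by (cases w) (auto simp: word_cons_def reduced_words_def successively_Cons)

context group
begin

lemma word_eval_closed:
  assumes "fst ` set w \<subseteq> carrier G"
  shows "word_eval G w \<in> carrier G"
  using assms by (induction w) auto

lemma word_eval_map_word_cons:
  assumes "f ` fst ` set w \<subseteq> carrier G" "f (fst p) \<in> carrier G"
  shows "word_eval G (map (map_prod f id) (word_cons p w)) =
         (if snd p then f (fst p) else inv (f (fst p))) \<otimes> word_eval G (map (map_prod f id) w)"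
proof (cases w)
  case (Cons q v)
  have "fst ` set (map (map_prod f id) v) \<subseteq> carrier G"
    using assms(1) Cons by (simp add: image_image)
  then have "word_eval G (map (map_prod f id) v) \<in> carrier G"
    by (rule word_eval_closed)
  then show ?thesis
    using assms Cons by (auto simp: word_cons_def inv_solve_left m_assoc[symmetric])
qed (auto simp: word_cons_def)

end

theorem free_on_universal:
  assumes F: "free_on F X" and H: "group H" and f: "f \<in> X \<rightarrow> carrier H"
  shows "\<exists>h \<in> hom F H. (\<forall>x\<in>X. h x = f x) \<and>
    (\<forall>h' \<in> hom F H. (\<forall>x\<in>X. h' x = f x) \<longrightarrow> (\<forall>y\<in>carrier F. h' y = h y))"
proof -
  interpret F: group F using F by (simp add: free_on_def)
  interpret H: group H by fact
  have X: "X \<subseteq> carrier F" using F by (simp add: free_on_def)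
  define wd where "wd = inv_into (reduced_words X) (word_eval F)"
  have bij: "bij_betw (word_eval F) (reduced_words X) (carrier F)"
    using F by (simp add: free_on_def)
  have wd: "wd y \<in> reduced_words X" "word_eval F (wd y) = y" if "y \<in> carrier F" for y
    using bij that unfolding wd_def bij_betw_def
    by (auto intro: inv_into_into f_inv_into_f)
  have wdI: "wd y = w" if "w \<in> reduced_words X" "word_eval F w = y" for y w
    using bij that unfolding wd_def bij_betw_def by (metis inv_into_f_f)
  have letters: "fst ` set w \<subseteq> X" if "w \<in> reduced_words X" for w
    using that by (simp add: reduced_words_def)
  define E where "E w = word_eval H (map (map_prod f id) w)" for w :: "('a \<times> bool) list"
  define h where "h y = E (wd y)" for y
  have Ecl: "E w \<in> carrier H" if "fst ` set w \<subseteq> X" for w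
    unfolding E_def using that f by (intro H.word_eval_closed) (force simp: Pi_iff)
  have hcl: "h y \<in> carrier H" if "y \<in> carrier F" for y
    unfolding h_def by (intro Ecl letters wd that)
  have step: "h ((if snd p then fst p else inv\<^bsub>F\<^esub> (fst p)) \<otimes>\<^bsub>F\<^esub> y)
      = (if snd p then f (fst p) else inv\<^bsub>H\<^esub> (f (fst p))) \<otimes>\<^bsub>H\<^esub> h y"
    if "fst p \<in> X" "y \<in> carrier F" for p y
  proof -
    have "fst ` set (wd y) \<subseteq> carrier F" "fst p \<in> carrier F"
      using letters[OF wd(1)[OF that(2)]] X that by auto
    then have "wd ((if snd p then fst p else inv\<^bsub>F\<^esub> (fst p)) \<otimes>\<^bsub>F\<^esub> y) = word_cons p (wd y)"
      using F.word_eval_map_word_cons[of id "wd y" p] that wd[of y]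
      by (intro wdI word_cons_reduced) (auto simp: map_prod.id)
    moreover have "f ` fst ` set (wd y) \<subseteq> carrier H"
      using letters[OF wd(1)[OF that(2)]] f by auto
    ultimately show ?thesis
      using H.word_eval_map_word_cons[of f "wd y" p] that f
      by (auto simp: h_def E_def Pi_iff)
  qed
  have Econs: "E (p # w) = (if snd p then f (fst p) else inv\<^bsub>H\<^esub> (f (fst p))) \<otimes>\<^bsub>H\<^esub> E w" for p w
    by (simp add: E_def)
  have mult: "h (word_eval F w \<otimes>\<^bsub>F\<^esub> y) = E w \<otimes>\<^bsub>H\<^esub> h y"
    if "fst ` set w \<subseteq> X" "y \<in> carrier F" for w y
    using that
  proof (induction w)
    case Nil
    then show ?case using hcl by (simp add: E_def)
  next
    case (Cons p w)
    then have cl: "word_eval F w \<in> carrier F" "fst p \<in> carrier F" "fst p \<in> X" "f (fst p) \<in> carrier H"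
      "E w \<in> carrier H" "h y \<in> carrier H"
      using X f hcl by (auto intro!: F.word_eval_closed Ecl)
    have "h (word_eval F (p # w) \<otimes>\<^bsub>F\<^esub> y)
        = h ((if snd p then fst p else inv\<^bsub>F\<^esub> (fst p)) \<otimes>\<^bsub>F\<^esub> (word_eval F w \<otimes>\<^bsub>F\<^esub> y))"
      using cl Cons.prems by (simp add: F.m_assoc)
    also have "\<dots> = E (p # w) \<otimes>\<^bsub>H\<^esub> h y"
      using Cons cl by (subst step) (auto simp: Econs H.m_assoc)
    finally show ?case .
  qed
  have hom: "h \<in> hom F H"
  proof (rule homI)
    fix x y assume "x \<in> carrier F" "y \<in> carrier F"
    then show "h (x \<otimes>\<^bsub>F\<^esub> y) = h x \<otimes>\<^bsub>H\<^esub> h y"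
      using mult[of "wd x" y] wd[of x] letters[of "wd x"] by (simp add: h_def)
  qed (rule hcl)
  have ext: "h x = f x" if "x \<in> X" for x
  proof -
    have "wd x = [(x, True)]" using that X by (intro wdI) (auto simp: reduced_words_def)
    then show ?thesis using that f by (auto simp: h_def E_def Pi_iff)
  qed
  have uniq: "h' y = h y"
    if h': "h' \<in> hom F H" "\<forall>x\<in>X. h' x = f x" and y: "y \<in> carrier F" for h' y
  proof -
    interpret h': group_hom F H h'
      using h'(1) by unfold_locales
    have "h' (word_eval F w) = E w" if "fst ` set w \<subseteq> X" for w
      using that
    proof (induction w)
      case (Cons p w)
      then have "fst p \<in> carrier F" "word_eval F w \<in> carrier F"
        using X by (auto intro!: F.word_eval_closed)
      then show ?case using Cons h'(2) by (auto simp: Econs)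
    qed (simp add: E_def)
    from this[of "wd y"] show ?thesis
      using wd[OF y] letters by (simp add: h_def)
  qed
  show ?thesis using hom ext uniq by blast
qed

end

(* If the subgroup generated by x^p is closed in the infinite cyclic group on x, then p divides the
   order of some group in V, since otherwise every neighbourhood of x meets this subgroup. By Sylow,
   V contains the group of order p, and by extensions every finite abelian group.

   Conversely, let V contain all finite abelian groups. By iterated wreath products with a group of
   order p, free groups are residually p-groups of V. Let c be nontrivial and g not a power of c. If g
   and c do not commute, then separating their commutator from 1 separates g from the powers of c.
   If they commute, they are powers of a common root r, say c = r^m and g = r^b with m not dividing b.
   Choose a prime power p^e that divides m but not b. In a finite p-group of V where the image of
   r^(p^(e-1)) is nontrivial, the order of the image of r is divisible by p^e, hence g is separated
   from the powers of c. *)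

theory Submission
  imports Defs "HOL-Algebra.Sylow" "HOL-Algebra.Multiplicative_Group" "HOL-Algebra.Weak_Morphisms"
begin

section \<open>Copies over the natural numbers and groups of prime order\<close>

text \<open>Quotients and wreath products have carriers of other types, while \<open>V\<close>
  consists of groups over \<open>nat\<close>. An injection of the finite carrier into
  \<open>nat\<close> transports the multiplication.\<close>

lemma finite_group_nat_copy:
  fixes G :: "'a monoid"
  assumes "group G" "finite (carrier G)"
  obtains H :: "nat monoid" and f
    where "group H" "finite (carrier H)" "f \<in> iso G H"
proof -
  obtain f :: "'a \<Rightarrow> nat" where "inj_on f (carrier G)"
    using finite_imp_inj_to_nat_seg[OF assms(2)] by blast
  then show thesis
    using that[of "image_group f G" f] assms group.inj_imp_image_group_is_group
      inj_imp_image_group_iso image_group_carrier by (metis finite_imageI)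
qed

lemma in_class_self: "G \<in> V \<Longrightarrow> group G \<Longrightarrow> in_class G V"
  unfolding in_class_def using iso_refl by blast

lemma in_classI:
  assumes "f \<in> iso G H" "H \<in> V" "group G"
  shows "in_class G V"
  using assms unfolding in_class_def is_iso_def by blast

text \<open>The order of a nontrivial element divides \<open>p\<close> and is not 1, so it is
  \<open>p\<close>. The powers of such an element identify either group with
  \<open>integer_mod_group p\<close>.\<close>

lemma prime_order_iso:
  assumes "group G" "group H" "prime p" "order G = p" "order H = p"
  shows "G \<cong> H"
proof -
  have "integer_mod_group p \<cong> K" if K: "group K" "order K = p" for K :: "('k, 'l) monoid_scheme"
  proof -
    interpret K: group K by fact
    have fin: "finite (carrier K)"
      using K(2) assms(3) by (metis K.order_gt_0_iff_finite prime_gt_0_nat)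
    obtain x where x: "x \<in> carrier K" "x \<noteq> \<one>\<^bsub>K\<^esub>"
    proof (rule ccontr)
      assume "\<not> thesis"
      then have "carrier K = {\<one>\<^bsub>K\<^esub>}" using that by blast
      then show False using K(2) assms(3) by (auto simp: order_def)
    qed
    have "K.ord x dvd p" using K.ord_dvd_group_order[OF x(1)] K(2) by simp
    then have ord: "K.ord x = p"
      using K.ord_eq_1[OF x(1)] x(2) assms(3) prime_nat_iff by blast
    define f where "f = (\<lambda>n::int. x [^]\<^bsub>K\<^esub> n)"
    have car: "carrier (integer_mod_group p) = {0..<int p}"
      using assms(3) by (simp add: carrier_integer_mod_group prime_gt_0_nat)
    have hom: "f \<in> hom (integer_mod_group p) K"
    proof (rule homI)
      fix a b :: int
      have "x [^]\<^bsub>K\<^esub> ((a + b) mod int p) = x [^]\<^bsub>K\<^esub> (a + b)"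
        by (subst K.int_pow_eq[OF x(1)]) (simp add: ord mod_eq_dvd_iff[symmetric])
      then show "f (a \<otimes>\<^bsub>integer_mod_group p\<^esub> b) = f a \<otimes>\<^bsub>K\<^esub> f b"
        using x(1) by (simp add: f_def K.int_pow_mult)
    qed (use x in \<open>auto simp: f_def\<close>)
    have inj: "inj_on f {0..<int p}"
      by (rule inj_onI)
        (auto simp: f_def K.int_pow_eq[OF x(1)] ord mod_eq_dvd_iff[symmetric])
    then have "f ` {0..<int p} = carrier K"
      using hom car fin K(2) by (intro card_subset_eq) (auto simp: card_image order_def hom_def)
    then show ?thesis
      using inj hom car by (auto simp: is_iso_def iso_def bij_betw_def)
  qed
  from this[OF assms(1,4)] this[OF assms(2,5)] show ?thesis
    using iso_trans group.iso_sym[OF group_integer_mod_group] by blast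
qed

section \<open>Finite abelian groups as iterated extensions\<close>

locale extension_closed_pseudovariety =
  fixes V :: "nat monoid set"
  assumes pseudovariety: "pseudovariety V" and extension_closed: "extension_closed V"
begin

lemma pv_group: "G \<in> V \<Longrightarrow> group G \<and> finite (carrier G)"
  using pseudovariety by (auto simp: pseudovariety_def)

lemma pv_subgroup: "G \<in> V \<Longrightarrow> subgroup H G \<Longrightarrow> G\<lparr>carrier := H\<rparr> \<in> V"
  using pseudovariety unfolding pseudovariety_def by blast

text \<open>Induction on the order: a subgroup \<open>N\<close> of prime order \<open>p\<close> is
  isomorphic to a subgroup of a member of \<open>V\<close>, and \<open>A Mod N\<close> is a smaller
  abelian group, so extension closure applies.\<close>

lemma finite_abelian_in_class:
  assumes primes: "\<And>p. prime p \<Longrightarrow> \<exists>H\<in>V. p dvd order H"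
    and nonempty: "V \<noteq> {}"
  shows "comm_group A \<Longrightarrow> finite (carrier A) \<Longrightarrow> A \<in> V"
proof (induction "order A" arbitrary: A rule: less_induct)
  case less
  interpret A: comm_group A by fact
  show ?case
  proof (cases "order A = 1")
    case True
    obtain H where H: "H \<in> V" using nonempty by blast
    interpret H: group H using pv_group[OF H] by simp
    have "carrier A = {\<one>\<^bsub>A\<^esub>}"
      using True A.one_closed unfolding order_def by (metis card_1_singletonE singletonD)
    \<comment> \<open>The trivial group is an image of every member of \<open>V\<close>.\<close>
    then have "(\<lambda>_. \<one>\<^bsub>A\<^esub>) \<in> epi H A" by (auto simp: epi_def hom_def)
    then show ?thesis using H A.is_group pseudovariety unfolding pseudovariety_def by blast
  next
    case False
    obtain p :: nat where p: "prime p" "p dvd order A"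
      using False prime_factor_nat by blast
    \<comment> \<open>With exponent 1, Sylow's theorem yields a subgroup of order
      \<open>p\<close>.\<close>
    obtain N where N: "subgroup N A" "card N = p"
      using sylow_thm[of p A 1] p less.prems A.is_group by (auto elim!: dvdE)
    obtain H where H: "H \<in> V" "p dvd order H" using primes[OF p(1)] by blast
    obtain P where P: "subgroup P H" "card P = p"
      using sylow_thm[of p H 1] p H pv_group[OF H(1)] by (auto elim!: dvdE)
    have "A\<lparr>carrier := N\<rparr> \<cong> H\<lparr>carrier := P\<rparr>"
      using N P p(1) pv_group[OF H(1)] A.subgroup_imp_group group.subgroup_imp_group
      by (intro prime_order_iso[of _ _ p]) (auto simp: order_def)
    then have 1: "in_class (A\<lparr>carrier := N\<rparr>) V"
      using pv_subgroup[OF H(1) P(1)] A.subgroup_imp_group[OF N(1)] unfolding in_class_def by blast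
    interpret Q: comm_group "A Mod N" by (rule A.abelian_FactGroup[OF N(1)])
    have ord: "order (A Mod N) * p = order A"
      using A.lagrange[OF N(1)] N(2) by (simp add: order_def FactGroup_def)
    have "order A > 0" using less.prems by (metis A.order_gt_0_iff_finite)
    then have pos: "order (A Mod N) > 0" using ord by (metis nat_0_less_mult_iff)
    then have less_ord: "order (A Mod N) < order A"
      using ord prime_gt_1_nat[OF p(1)] by (metis n_less_m_mult_n mult.commute One_nat_def)
    have fin: "finite (carrier (A Mod N))" using pos by (metis Q.order_gt_0_iff_finite)
    \<comment> \<open>The induction hypothesis speaks of groups over \<open>nat\<close>, so it is
      applied to a copy of the quotient.\<close>
    obtain B :: "nat monoid" and f where B: "group B" "finite (carrier B)" "f \<in> iso (A Mod N) B"
      using finite_group_nat_copy[OF Q.is_group fin] .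
    have "comm_group B"
      using Q.iso_imp_comm_group[OF is_isoI[OF B(3)] group.is_monoid[OF B(1)]] .
    moreover have "order B = order (A Mod N)"
      using iso_same_order[OF B(3)] by simp
    ultimately have "B \<in> V" using less.hyps[of B] less_ord B by simp
    then have "in_class (A Mod N) V" using in_classI[OF B(3)] Q.is_group by blast
    then show ?thesis
      using extension_closed 1 A.is_group less.prems A.subgroup_imp_normal[OF N(1)]
      unfolding extension_closed_def by blast
  qed
qed

end

section \<open>Extensions with abelian kernel and wreath products\<close>

locale abelian_pseudovariety = extension_closed_pseudovariety +
  assumes finite_abelian: "comm_group A \<Longrightarrow> finite (carrier A) \<Longrightarrow> A \<in> V"
begin

text \<open>The kernel is finite abelian and the quotient by it is \<open>H\<close>, so extension
  closure applies to a copy \<open>K\<close> of \<open>G\<close> over \<open>nat\<close>. This puts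
  the wreath products below into the class.\<close>

lemma abelian_extension:
  fixes G :: "'g monoid"
  assumes G: "group G" "finite (carrier G)" and H: "H \<in> V" and h: "h \<in> epi G H"
    and comm: "\<And>x y. x \<in> kernel G H h \<Longrightarrow> y \<in> kernel G H h \<Longrightarrow> x \<otimes>\<^bsub>G\<^esub> y = y \<otimes>\<^bsub>G\<^esub> x"
  shows "\<exists>K\<in>V. \<exists>f. f \<in> iso G K"
proof -
  obtain K :: "nat monoid" and f where K: "group K" "finite (carrier K)" "f \<in> iso G K"
    using finite_group_nat_copy[OF G] .
  interpret G: group G by fact
  interpret K: group K by fact
  interpret H: group H using pv_group[OF H] by simp
  define g where "g = inv_into (carrier G) f"
  have g: "g \<in> iso K G" unfolding g_def by (rule G.iso_set_sym[OF K(3)])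
  have hg: "h \<circ> g \<in> epi K H"
    using g h hom_compose[of g K G h H] image_comp[of h g "carrier K"]
    by (auto simp: epi_def iso_def bij_betw_def)
  interpret hg: group_hom K H "h \<circ> g"
    using hg by unfold_locales (auto simp: epi_def)
  define N where "N = kernel K H (h \<circ> g)"
  have N: "N \<lhd> K" unfolding N_def by (rule hg.normal_kernel)
  have "comm_group (K\<lparr>carrier := N\<rparr>)"
  proof (rule group.group_comm_groupI)
    show "group (K\<lparr>carrier := N\<rparr>)"
      using K.subgroup_imp_group normal_imp_subgroup[OF N] by blast
    fix x y assume "x \<in> carrier (K\<lparr>carrier := N\<rparr>)" "y \<in> carrier (K\<lparr>carrier := N\<rparr>)"
    then have xy: "x \<in> N" "y \<in> N" "x \<in> carrier K" "y \<in> carrier K"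
      by (auto simp: N_def kernel_def)
    then have "g x \<in> kernel G H h" "g y \<in> kernel G H h"
      using g by (auto simp: N_def kernel_def iso_def hom_def)
    then have "g (x \<otimes>\<^bsub>K\<^esub> y) = g (y \<otimes>\<^bsub>K\<^esub> x)"
      using comm g xy hom_mult[of g K G] by (simp add: iso_def)
    then show "x \<otimes>\<^bsub>K\<lparr>carrier := N\<rparr>\<^esub> y = y \<otimes>\<^bsub>K\<lparr>carrier := N\<rparr>\<^esub> x"
      using g xy by (auto simp: iso_def bij_betw_def dest: inj_onD)
  qed
  moreover have "finite N" using K(2) by (simp add: N_def kernel_def)
  ultimately have 1: "K\<lparr>carrier := N\<rparr> \<in> V" by (intro finite_abelian) auto
  have "K Mod N \<cong> H"
    unfolding N_def using hg by (intro hg.FactGroup_iso) (auto simp: epi_def)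
  then have "in_class (K Mod N) V"
    using H normal.factorgroup_is_group[OF N] unfolding in_class_def by blast
  moreover have "in_class (K\<lparr>carrier := N\<rparr>) V"
    using 1 pv_group in_class_self by blast
  ultimately have "K \<in> V"
    using extension_closed K N unfolding extension_closed_def by blast
  then show ?thesis using K(3) by blast
qed

end

text \<open>The regular wreath product, with \<open>G\<close> acting on functions by right
  translation. If \<open>s\<close> is read as a vertex of the Cayley graph of \<open>G\<close>, the
  first component of a product at \<open>s\<close> multiplies the contributions of the factors along
  the path that starts at \<open>s\<close>.\<close>

definition wreath :: "('a, 'c) monoid_scheme \<Rightarrow> ('b, 'd) monoid_scheme \<Rightarrow> (('b \<Rightarrow> 'a) \<times> 'b) monoid"
  where "wreath A G =
    \<lparr>carrier = (carrier G \<rightarrow>\<^sub>E carrier A) \<times> carrier G,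
     monoid.mult = (\<lambda>x y. (\<lambda>s\<in>carrier G. fst x s \<otimes>\<^bsub>A\<^esub> fst y (s \<otimes>\<^bsub>G\<^esub> snd x), snd x \<otimes>\<^bsub>G\<^esub> snd y)),
     one = (\<lambda>s\<in>carrier G. \<one>\<^bsub>A\<^esub>, \<one>\<^bsub>G\<^esub>)\<rparr>"

lemma mem_carrier_wreath:
  "x \<in> carrier (wreath A G) \<longleftrightarrow> fst x \<in> carrier G \<rightarrow>\<^sub>E carrier A \<and> snd x \<in> carrier G"
  by (simp add: wreath_def mem_Times_iff)

lemma group_wreath:
  assumes "group A" "group G"
  shows "group (wreath A G)"
proof -
  interpret A: group A by fact
  interpret G: group G by fact
  have cl: "fst x s \<in> carrier A" if "x \<in> carrier (wreath A G)" "s \<in> carrier G" for x s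
    using that unfolding mem_carrier_wreath by (metis PiE_mem)
  show ?thesis
  proof (rule groupI)
    show "x \<otimes>\<^bsub>wreath A G\<^esub> y \<in> carrier (wreath A G)"
      if "x \<in> carrier (wreath A G)" "y \<in> carrier (wreath A G)" for x y
      using that cl by (simp add: mem_carrier_wreath) (simp add: wreath_def)
    show "\<one>\<^bsub>wreath A G\<^esub> \<in> carrier (wreath A G)" by (simp add: wreath_def)
    show "x \<otimes>\<^bsub>wreath A G\<^esub> y \<otimes>\<^bsub>wreath A G\<^esub> z = x \<otimes>\<^bsub>wreath A G\<^esub> (y \<otimes>\<^bsub>wreath A G\<^esub> z)"
      if "x \<in> carrier (wreath A G)" "y \<in> carrier (wreath A G)" "z \<in> carrier (wreath A G)" for x y z
      using that cl[of x] cl[of y] cl[of z]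
      by (simp add: mem_carrier_wreath) (simp add: wreath_def G.m_assoc A.m_assoc cong: restrict_cong)
    fix x assume x: "x \<in> carrier (wreath A G)"
    obtain u g where [simp]: "x = (u, g)" by (cases x)
    have ug: "u \<in> carrier G \<rightarrow>\<^sub>E carrier A" "g \<in> carrier G" using x by (simp_all add: mem_carrier_wreath)
    have ucl: "u s \<in> carrier A" if "s \<in> carrier G" for s using ug(1) that by (rule PiE_mem)
    have "(\<lambda>s\<in>carrier G. u s) = u" using ug(1) by (simp add: PiE_iff extensional_restrict)
    then show "\<one>\<^bsub>wreath A G\<^esub> \<otimes>\<^bsub>wreath A G\<^esub> x = x"
      using ug(2) ucl by (simp add: wreath_def cong: restrict_cong)
    show "\<exists>y\<in>carrier (wreath A G). y \<otimes>\<^bsub>wreath A G\<^esub> x = \<one>\<^bsub>wreath A G\<^esub>"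
    proof
      \<comment> \<open>The shift by the inverse of \<open>g\<close> makes both factors of the
        product with \<open>x\<close> use the same value of \<open>u\<close>.\<close>
      let ?y = "(\<lambda>s\<in>carrier G. inv\<^bsub>A\<^esub> u (s \<otimes>\<^bsub>G\<^esub> inv\<^bsub>G\<^esub> g), inv\<^bsub>G\<^esub> g)"
      show "?y \<in> carrier (wreath A G)" using ug(2) ucl by (simp add: wreath_def)
      show "?y \<otimes>\<^bsub>wreath A G\<^esub> x = \<one>\<^bsub>wreath A G\<^esub>"
        using ug(2) ucl by (simp add: wreath_def cong: restrict_cong)
    qed
  qed
qed

lemma order_wreath:
  assumes "finite (carrier A)" "finite (carrier G)"
  shows "finite (carrier (wreath A G))" "order (wreath A G) = order A ^ order G * order G"
  using assms by (auto simp: wreath_def order_def card_cartesian_product card_PiE intro!: finite_PiE)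

lemma snd_wreath_epi:
  assumes "group A" "group G"
  shows "snd \<in> epi (wreath A G) G"
proof -
  interpret A: group A by fact
  have "(\<lambda>s\<in>carrier G. \<one>\<^bsub>A\<^esub>) \<in> carrier G \<rightarrow>\<^sub>E carrier A" by auto
  then have "snd ` ((carrier G \<rightarrow>\<^sub>E carrier A) \<times> carrier G) = carrier G"
    by (metis empty_iff snd_image_times)
  then show ?thesis
    by (auto simp: epi_def hom_def wreath_def)
qed

section \<open>Residual finiteness of free groups by \<open>p\<close>-groups of the class\<close>

lemma word_eval_append:
  assumes "group G" "fst ` set u \<subseteq> carrier G" "fst ` set v \<subseteq> carrier G"
  shows "word_eval G (u @ v) = word_eval G u \<otimes>\<^bsub>G\<^esub> word_eval G v"
proof -
  interpret group G by fact
  show ?thesis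
    using assms(2,3) by (induction u) (auto simp: m_assoc word_eval_closed)
qed

lemma reduced_words_take: "w \<in> reduced_words X \<Longrightarrow> take n w \<in> reduced_words X"
  using set_take_subset[of n w] successively_append_iff[of _ "take n w" "drop n w"]
  unfolding reduced_words_def append_take_drop_id by blast

lemma reduced_words_adjacent:
  assumes "w \<in> reduced_words X" "Suc i < length w" "fst (w ! i) = fst (w ! Suc i)"
  shows "snd (w ! i) = snd (w ! Suc i)"
  using assms by (auto simp: reduced_words_def successively_conv_nth)

text \<open>A reduced word traces a path in the Cayley graph of a finite quotient \<open>H\<close>. If its first
  \<open>n + 1\<close> vertices are distinct, then the path does not run through the edge of step \<open>n + 1\<close>
  before that step. The function supported on this edge defines a homomorphism into a wreath product
  that separates the next vertex from all earlier ones.\<close>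

lemma (in abelian_pseudovariety) separate_prefixes:
  fixes p :: nat
  assumes p: "prime p" and F: "free_on F X" and w: "w \<in> reduced_words X"
  shows "n \<le> length w \<Longrightarrow> \<exists>H\<in>V. \<exists>h\<in>hom F H. (\<exists>k. order H = p ^ k) \<and>
    inj_on (\<lambda>i. h (word_eval F (take i w))) {..n}"
proof (induction n)
  case 0
  define H :: "nat monoid" where "H = singleton_group 0"
  have "comm_group H" "finite (carrier H)" "order H = p ^ 0" by (auto simp: H_def order_def)
  moreover have "(\<lambda>_. 0) \<in> hom F H" by (auto simp: H_def hom_def singleton_group_def)
  ultimately show ?case
    using finite_abelian by (intro bexI[of _ H] bexI[of _ "\<lambda>_. 0"] conjI exI[of _ 0]) auto
next
  case (Suc n)
  then obtain H h k where H: "H \<in> V" "order H = p ^ k" and h: "h \<in> hom F H"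
    and inj: "inj_on (\<lambda>i. h (word_eval F (take i w))) {..n}" by auto
  interpret F: group F using F by (simp add: free_on_def)
  interpret H: group H using pv_group[OF H(1)] by simp
  have finH: "finite (carrier H)" using pv_group[OF H(1)] by simp
  interpret h: group_hom F H h by unfold_locales (rule h)
  have X: "X \<subseteq> carrier F" using F by (simp add: free_on_def)
  define A where "A = integer_mod_group p"
  interpret A: comm_group A unfolding A_def by simp
  have carA: "carrier A = {0..<int p}"
    using prime_gt_0_nat[OF p] by (simp add: A_def carrier_integer_mod_group)
  have a: "1 \<in> carrier A" "1 \<noteq> \<one>\<^bsub>A\<^esub>" using prime_gt_1_nat[OF p] by (auto simp: carA A_def)
  define W where "W = wreath A H"
  interpret W: group W unfolding W_def by (rule group_wreath) unfold_locales
  have sndW: "snd \<in> epi W H" unfolding W_def by (rule snd_wreath_epi) unfold_locales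

  define e where "e i = word_eval F (take i w)" for i
  define x where "x = fst (w ! n)"
  \<comment> \<open>The start, in \<open>H\<close>, of the edge labelled \<open>x\<close> that the
    letter \<open>w ! n\<close> follows. An inverse letter runs through its edge backwards, so the
    edge then starts at vertex \<open>Suc n\<close>.\<close>
  define q where "q = (if snd (w ! n) then h (e n) else h (e (Suc n)))"
  \<comment> \<open>Every generator moves the vertices as \<open>h\<close> does; only the edge from
    \<open>q\<close> labelled \<open>x\<close> has nonzero weight.\<close>
  define f where "f y = (\<lambda>s\<in>carrier H. if y = x \<and> s = q then 1 else \<one>\<^bsub>A\<^esub>, h y)" for y
  have letters: "fst ` set (take i w) \<subseteq> carrier F" for i
    using reduced_words_take[OF w, of i] X by (auto simp: reduced_words_def)
  have ecl: "e i \<in> carrier F" for i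
    unfolding e_def by (rule F.word_eval_closed) (rule letters)
  have letter: "fst (w ! i) \<in> X" if "i < length w" for i
    using w that by (auto simp: reduced_words_def)
  have eSuc: "e (Suc i) = e i \<otimes>\<^bsub>F\<^esub> (if snd (w ! i) then fst (w ! i) else inv\<^bsub>F\<^esub> fst (w ! i))"
    if "i < length w" for i
    unfolding e_def take_Suc_conv_app_nth[OF that] using letter[OF that] X letters
    by (subst word_eval_append[OF F.is_group]) auto
  have fW: "f \<in> X \<rightarrow> carrier W"
    using X a by (auto simp: f_def W_def wreath_def)
  obtain g where g: "g \<in> hom F W" "\<And>y. y \<in> X \<Longrightarrow> g y = f y"
    using free_on_universal[OF F W.is_group fW] by blast
  interpret g: group_hom F W g by unfold_locales (rule g)
  \<comment> \<open>Both \<open>snd \<circ> g\<close> and \<open>h\<close> extend the same map on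
    \<open>X\<close>, so the uniqueness in the universal property applies.\<close>
  have sndg: "snd (g y) = h y" if "y \<in> carrier F" for y
  proof -
    have 1: "snd \<circ> g \<in> hom F H" using g(1) sndW hom_compose[of g F W snd H] by (simp add: epi_def)
    have 2: "\<forall>y\<in>X. (snd \<circ> g) y = h y" using g(2) by (simp add: f_def)
    have "h \<in> X \<rightarrow> carrier H" using X by auto
    then obtain h0 where "\<forall>h'\<in>hom F H. (\<forall>x\<in>X. h' x = h x) \<longrightarrow> (\<forall>y\<in>carrier F. h' y = h0 y)"
      using free_on_universal[OF F H.is_group] by blast
    from bspec[OF this 1] bspec[OF this h] 2 that show ?thesis by simp
  qed
  \<comment> \<open>The total weight of a path from the identity vertex to \<open>h y\<close>: the
    number of signed traversals of the chosen edge modulo \<open>p\<close>.\<close>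
  define u where "u y = fst (g y) \<one>\<^bsub>H\<^esub>" for y
  have ucl: "u y \<in> carrier A" if "y \<in> carrier F" for y
    using g.hom_closed[OF that] by (auto simp: u_def W_def wreath_def)
  have ustep: "u (y \<otimes>\<^bsub>F\<^esub> z) = (if z = x \<and> h y = q then u y \<otimes>\<^bsub>A\<^esub> 1 else u y)"
    if "y \<in> carrier F" "z \<in> X" for y z
  proof -
    have "z \<in> carrier F" using that X by auto
    then have "g (y \<otimes>\<^bsub>F\<^esub> z) = g y \<otimes>\<^bsub>W\<^esub> f z" using that g(2) by simp
    then show ?thesis
      using that sndg[OF that(1)] ucl[OF that(1)] by (auto simp: u_def W_def wreath_def f_def)
  qed
  have ustep_inv: "u y = (if z = x \<and> h (y \<otimes>\<^bsub>F\<^esub> inv\<^bsub>F\<^esub> z) = q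
      then u (y \<otimes>\<^bsub>F\<^esub> inv\<^bsub>F\<^esub> z) \<otimes>\<^bsub>A\<^esub> 1 else u (y \<otimes>\<^bsub>F\<^esub> inv\<^bsub>F\<^esub> z))"
    if "y \<in> carrier F" "z \<in> X" for y z
  proof -
    have z: "z \<in> carrier F" using that X by auto
    then have "y \<otimes>\<^bsub>F\<^esub> inv\<^bsub>F\<^esub> z \<otimes>\<^bsub>F\<^esub> z = y" using that by (simp add: F.m_assoc)
    then show ?thesis using ustep[of "y \<otimes>\<^bsub>F\<^esub> inv\<^bsub>F\<^esub> z" z] that z by simp
  qed
  \<comment> \<open>If the letters \<open>i\<close> and \<open>n\<close> follow the same edge, its
    two ends agree. Since the vertices up to \<open>n\<close> are distinct, either
    \<open>i = n\<close> or the letter \<open>n\<close> directly follows and cancels the letter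
    \<open>i\<close>. Both are impossible.\<close>
  have crossing: False
    if i: "i < n" "fst (w ! i) = x" "h (if snd (w ! i) then e i else e (Suc i)) = q" for i
  proof -
    have n: "n < length w" "i < length w" using i(1) Suc.prems by auto
    have hx: "h x \<in> carrier H" using letter[OF n(1)] X by (auto simp: x_def)
    have hstep: "h (e (if snd (w ! j) then Suc j else j)) = h (e (if snd (w ! j) then j else Suc j)) \<otimes>\<^bsub>H\<^esub> h x"
      if "j < length w" "fst (w ! j) = x" for j
    proof -
      have x: "x \<in> carrier F" using letter[OF n(1)] X by (auto simp: x_def)
      show ?thesis
        using eSuc[OF that(1)] that(2) x ecl[of j] hx by (auto simp: H.m_assoc)
    qed
    have "h (e (if snd (w ! i) then i else Suc i)) = h (e (if snd (w ! n) then n else Suc n))"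
      using i(3) by (auto simp: q_def)
    moreover from this
    have "h (e (if snd (w ! i) then Suc i else i)) = h (e (if snd (w ! n) then Suc n else n))"
      using hstep[OF n(2) i(2)] hstep[OF n(1)] by (simp add: x_def)
    ultimately have "i = n \<or> (Suc i = n \<and> snd (w ! i) \<noteq> snd (w ! n))"
      using inj i(1) by (auto simp: inj_on_def e_def split: if_splits)
    then show False
      using reduced_words_adjacent[OF w, of i] n i by (auto simp: x_def)
  qed
  have u0: "u (e i) = \<one>\<^bsub>A\<^esub>" if "i \<le> n" for i
    using that
  proof (induction i)
    case 0
    have "g (e 0) = \<one>\<^bsub>W\<^esub>" by (simp add: e_def)
    then show ?case by (simp add: u_def W_def wreath_def)
  next
    case (Suc i)
    then have i: "i < n" "i < length w" using \<open>Suc n \<le> length w\<close> by auto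
    show ?case
      using Suc i crossing[OF i(1)] ustep[OF ecl[of i] letter[OF i(2)]]
        ustep_inv[OF ecl[of i] letter[OF i(2)]] eSuc[OF i(2)]
      by (auto split: if_splits)
  qed
  have u1: "u (e (Suc n)) \<noteq> \<one>\<^bsub>A\<^esub>"
  proof -
    have n: "n < length w" using \<open>Suc n \<le> length w\<close> by simp
    show ?thesis
    proof (cases "snd (w ! n)")
      case True
      then show ?thesis
        using ustep[OF ecl[of n] letter[OF n]] eSuc[OF n] u0[of n] a by (simp add: x_def q_def)
    next
      case False
      \<comment> \<open>The last letter leads backwards along the edge: going forward again from
        vertex \<open>Suc n\<close> adds 1 and returns to weight zero.\<close>
      then have "\<one>\<^bsub>A\<^esub> = u (e (Suc n)) \<otimes>\<^bsub>A\<^esub> 1"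
        using ustep_inv[OF ecl[of n] letter[OF n]] eSuc[OF n] u0[of n] by (simp add: x_def q_def)
      then show ?thesis using a A.l_one by metis
    qed
  qed
  \<comment> \<open>Earlier vertices stay distinct by their second components; the weight separates
    the new vertex from them.\<close>
  have gdist: "inj_on (\<lambda>i. g (e i)) {..Suc n}"
  proof -
    have "inj_on (\<lambda>i. g (e i)) {..n}"
      using inj sndg[OF ecl] unfolding inj_on_def e_def by metis
    moreover have "g (e (Suc n)) \<noteq> g (e i)" if "i \<le> n" for i
      using u0[OF that] u1 by (auto simp: u_def)
    ultimately show ?thesis by (auto simp: atMost_Suc)
  qed
  have finA: "finite (carrier A)" "order A = p" by (auto simp: carA order_def)
  have finW: "finite (carrier W)" "order W = p ^ (p ^ k) * p ^ k"
    using order_wreath[OF finA(1) finH] finA H(2) by (auto simp: W_def)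
  \<comment> \<open>The kernel of \<open>snd\<close> consists of functions into the abelian group
    \<open>A\<close>, multiplied pointwise.\<close>
  have "\<exists>K\<in>V. \<exists>f. f \<in> iso W K"
  proof (rule abelian_extension[OF W.is_group finW(1) H(1) sndW])
    fix y z assume "y \<in> kernel W H snd" "z \<in> kernel W H snd"
    then show "y \<otimes>\<^bsub>W\<^esub> z = z \<otimes>\<^bsub>W\<^esub> y"
      by (auto simp: kernel_def W_def wreath_def fun_eq_iff PiE_iff A.m_comm)
  qed
  then obtain K j where K: "K \<in> V" and j: "j \<in> iso W K" by blast
  have "j \<circ> g \<in> hom F K" using g(1) j hom_compose[of g F W j K] by (simp add: iso_def)
  moreover have "order K = p ^ (p ^ k + k)"
    using iso_same_order[OF j] finW(2) by (simp add: power_add)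
  moreover have "inj_on (\<lambda>i. (j \<circ> g) (word_eval F (take i w))) {..Suc n}"
    using gdist j ecl g.hom_closed unfolding inj_on_def iso_def bij_betw_def e_def
    by (auto dest!: inj_onD)
  ultimately show ?case using K by blast
qed

lemma free_on_word:
  assumes "free_on F X" "g \<in> carrier F"
  obtains w where "w \<in> reduced_words X" "word_eval F w = g"
proof -
  have "g \<in> word_eval F ` reduced_words X"
    using assms by (simp add: free_on_def bij_betw_def)
  then show thesis using that by auto
qed

text \<open>The empty word and the full reduced word of \<open>g\<close> are two of the prefixes
  that \<open>separate_prefixes\<close> keeps distinct.\<close>

lemma (in abelian_pseudovariety) residually_p:
  fixes p :: nat
  assumes p: "prime p" and F: "free_on F X" and g: "g \<in> carrier F" "g \<noteq> \<one>\<^bsub>F\<^esub>"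
  obtains H h k where "H \<in> V" "h \<in> hom F H" "order H = p ^ k" "h g \<noteq> \<one>\<^bsub>H\<^esub>"
proof -
  obtain w where w: "w \<in> reduced_words X" "word_eval F w = g"
    using free_on_word[OF F g(1)] .
  then have "w \<noteq> []" using g(2) by auto
  obtain H h k where H: "H \<in> V" "h \<in> hom F H" "order H = p ^ k"
    and inj: "inj_on (\<lambda>i. h (word_eval F (take i w))) {..length w}"
    using separate_prefixes[OF p F w(1), of "length w"] by auto
  interpret F: group F using F by (simp add: free_on_def)
  interpret H: group H using pv_group[OF H(1)] by simp
  interpret h: group_hom F H h by unfold_locales (rule H(2))
  have "h g \<noteq> h \<one>\<^bsub>F\<^esub>"
    using inj_onD[OF inj, of "length w" 0] w(2) \<open>w \<noteq> []\<close> by auto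
  then show thesis using that[OF H] by simp
qed

section \<open>Cancellation in words and commuting elements\<close>

text \<open>For a nonempty reduced word \<open>c\<close>, the condition
  \<open>compat (last c) (hd c)\<close> says that \<open>c\<close> is cyclically reduced.\<close>

abbreviation compat :: "'a \<times> bool \<Rightarrow> 'a \<times> bool \<Rightarrow> bool"
  where "compat p q \<equiv> \<not> (fst p = fst q \<and> snd p \<noteq> snd q)"

definition inverse_word :: "('a \<times> bool) list \<Rightarrow> ('a \<times> bool) list"
  where "inverse_word w = rev (map (\<lambda>p. (fst p, \<not> snd p)) w)"

lemma reduced_words_append:
  "u @ v \<in> reduced_words X \<longleftrightarrow> u \<in> reduced_words X \<and> v \<in> reduced_words X \<and>
    (u = [] \<or> v = [] \<or> compat (last u) (hd v))"
  by (auto simp: reduced_words_def successively_append_iff)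

text \<open>Cancellation at the junction proceeds letter by letter from the end of \<open>u\<close>;
  \<open>s\<close> is the suffix of \<open>u\<close> that disappears.\<close>

lemma reduced_product:
  assumes "u \<in> reduced_words X" "v \<in> reduced_words X"
  shows "\<exists>u' s v'. u = u' @ s \<and> v = inverse_word s @ v' \<and> u' @ v' \<in> reduced_words X"
  using assms
proof (induction u arbitrary: v rule: rev_induct)
  case Nil
  then show ?case by (auto simp: inverse_word_def)
next
  case (snoc p u)
  show ?case
  proof (cases "v = [] \<or> compat p (hd v)")
    case True
    then have "(u @ [p]) @ v \<in> reduced_words X"
      using snoc.prems by (subst reduced_words_append) auto
    then show ?thesis by (intro exI[of _ "u @ [p]"] exI[of _ "[]"] exI[of _ v]) (auto simp: inverse_word_def)
  next
    case False
    then obtain v1 where v1: "v = (fst p, \<not> snd p) # v1"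
      by (cases v) (auto simp: prod_eq_iff)
    moreover have "u \<in> reduced_words X" "v1 \<in> reduced_words X"
      using snoc.prems v1 by (simp_all add: reduced_words_append reduced_words_append[of "[_]" v1, simplified])
    ultimately obtain u' s v' where "u = u' @ s" "v1 = inverse_word s @ v'" "u' @ v' \<in> reduced_words X"
      using snoc.IH[of v1] by blast
    then show ?thesis using v1
      by (intro exI[of _ u'] exI[of _ "s @ [p]"] exI[of _ v']) (auto simp: inverse_word_def)
  qed
qed

text \<open>All junctions between copies of \<open>c\<close> satisfy \<open>compat\<close>. The
  first and last letters are recorded because they control further junctions.\<close>

lemma cyclically_reduced_power:
  assumes "c \<in> reduced_words X" "c \<noteq> []" "compat (last c) (hd c)"
  shows "concat (replicate n c) \<in> reduced_words X \<and>
    (n > 0 \<longrightarrow> concat (replicate n c) \<noteq> [] \<and> hd (concat (replicate n c)) = hd c \<and>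
      last (concat (replicate n c)) = last c)"
proof (induction n)
  case 0
  then show ?case by (simp add: reduced_words_def)
next
  case (Suc n)
  then show ?case using assms by (cases "n = 0") (auto simp: reduced_words_append)
qed

lemma length_concat_replicate: "length (concat (replicate n c)) = n * length c"
  by (induction n) auto

context group
begin

lemma word_eval_inverse_word:
  assumes "fst ` set w \<subseteq> carrier G"
  shows "word_eval G (inverse_word w) = inv (word_eval G w)"
  using assms
proof (induction w)
  case (Cons p w)
  have "fst ` set (inverse_word w) \<subseteq> carrier G"
    using Cons.prems by (auto simp: inverse_word_def)
  moreover have "inverse_word (p # w) = inverse_word w @ [(fst p, \<not> snd p)]"
    by (simp add: inverse_word_def)
  ultimately show ?case
    using Cons by (auto simp: word_eval_append[OF is_group] inv_mult_group word_eval_closed)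
qed (simp add: inverse_word_def)

lemma word_eval_power:
  assumes "fst ` set w \<subseteq> carrier G"
  shows "word_eval G (concat (replicate n w)) = word_eval G w [^] n"
proof (induction n)
  case (Suc n)
  have "set (concat (replicate n w)) \<subseteq> set w" by auto
  then have "fst ` set (concat (replicate n w)) \<subseteq> carrier G" using assms by blast
  then show ?case
    using Suc assms word_eval_closed[OF assms] nat_pow_Suc2
    by (auto simp: word_eval_append[OF is_group] simp del: nat_pow_Suc)
qed simp

lemma int_pow_conjugate:
  assumes "x \<in> carrier G" "y \<in> carrier G"
  shows "(y \<otimes> x \<otimes> inv y) [^] (k::int) = y \<otimes> x [^] k \<otimes> inv y"
proof -
  interpret group_hom G G "\<lambda>x. y \<otimes> x \<otimes> inv y"
    using assms(2) by unfold_locales (auto simp: hom_def m_assoc inv_solve_left)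
  show ?thesis using hom_int_pow[OF assms(1)] by simp
qed

end

text \<open>Multiplying \<open>g\<close> by a high power of the cyclically reduced word \<open>c\<close> yields an element whose
  reduced word \<open>w\<close> begins like \<open>c\<close> and ends like \<open>c\<close>. Then \<open>c w\<close> and \<open>w c\<close> are reduced, and the
  commutation takes place in the free monoid.\<close>

lemma commuting_common_root:
  assumes F: "free_on F X"
    and c: "c \<in> reduced_words X" "c \<noteq> []" "compat (last c) (hd c)"
    and g: "g \<in> carrier F" and comm: "word_eval F c \<otimes>\<^bsub>F\<^esub> g = g \<otimes>\<^bsub>F\<^esub> word_eval F c"
  obtains r and m :: nat and b :: int
    where "r \<in> carrier F" "m > 0" "word_eval F c = r [^]\<^bsub>F\<^esub> m" "g = r [^]\<^bsub>F\<^esub> b"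
proof -
  interpret F: group F using F by (simp add: free_on_def)
  have X: "X \<subseteq> carrier F" and inj: "inj_on (word_eval F) (reduced_words X)"
    using F by (auto simp: free_on_def bij_betw_def)
  have letters: "fst ` set w \<subseteq> carrier F" if "w \<in> reduced_words X" for w
    using that X by (auto simp: reduced_words_def)
  note ev = F.word_eval_closed[OF letters] and app = word_eval_append[OF F.is_group]
  obtain v where v: "v \<in> reduced_words X" "word_eval F v = g"
    using free_on_word[OF F g] .
  \<comment> \<open>One more copy of the nonempty word \<open>c\<close> than \<open>v\<close> has
    letters makes \<open>P\<close> longer than \<open>v\<close>, so cancellation against
    \<open>v\<close> cannot use up \<open>P\<close>.\<close>
  define N where "N = Suc (length v)"
  define P where "P = concat (replicate N c)"
  have P: "P \<in> reduced_words X" "P \<noteq> []" "hd P = hd c" "last P = last c"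
    using cyclically_reduced_power[OF c, of N] by (auto simp: P_def N_def)
  have lenP: "length P > length v"
    using c(2) by (cases "length c") (auto simp: P_def N_def length_concat_replicate)
  let ?C = "word_eval F c"
  have evP: "word_eval F P = ?C [^]\<^bsub>F\<^esub> N"
    unfolding P_def by (rule F.word_eval_power[OF letters[OF c(1)]])
  have commP: "?C [^]\<^bsub>F\<^esub> N \<otimes>\<^bsub>F\<^esub> g = g \<otimes>\<^bsub>F\<^esub> ?C [^]\<^bsub>F\<^esub> N"
    using F.group_commutes_pow[of ?C g N] comm g ev[OF c(1)] by simp
  \<comment> \<open>Reducing \<open>P @ v\<close> keeps the beginning \<open>u1\<close> of
    \<open>P\<close>; reducing \<open>v @ P\<close> keeps the end \<open>v2\<close> of
    \<open>P\<close>.\<close>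
  obtain u1 s v1 where 1: "P = u1 @ s" "v = inverse_word s @ v1" "u1 @ v1 \<in> reduced_words X"
    using reduced_product[OF P(1) v(1)] by blast
  obtain u2 t v2 where 2: "v = u2 @ t" "P = inverse_word t @ v2" "u2 @ v2 \<in> reduced_words X"
    using reduced_product[OF v(1) P(1)] by blast
  have ne: "u1 \<noteq> []" "v2 \<noteq> []"
    using lenP arg_cong[OF 1(1), of length] arg_cong[OF 1(2), of length]
      arg_cong[OF 2(1), of length] arg_cong[OF 2(2), of length]
    by (auto simp: inverse_word_def)
  have cancel: "word_eval F (u @ v) = word_eval F (u @ s) \<otimes>\<^bsub>F\<^esub> word_eval F (inverse_word s @ v)"
    if us: "u @ s \<in> reduced_words X" and sv: "inverse_word s @ v \<in> reduced_words X" for u s v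
  proof -
    have l: "fst ` set u \<subseteq> carrier F" "fst ` set s \<subseteq> carrier F" "fst ` set v \<subseteq> carrier F"
      "fst ` set (inverse_word s) \<subseteq> carrier F"
      using letters us sv by (auto simp: reduced_words_append)
    note e = F.word_eval_closed[OF l(1)] F.word_eval_closed[OF l(2)] F.word_eval_closed[OF l(3)]
    have "word_eval F s \<otimes>\<^bsub>F\<^esub> (inv\<^bsub>F\<^esub> word_eval F s \<otimes>\<^bsub>F\<^esub> word_eval F v) = word_eval F v"
      using e by (simp add: F.m_assoc[symmetric])
    then show ?thesis
      using e by (simp add: app l F.word_eval_inverse_word F.m_assoc)
  qed
  define w where "w = u1 @ v1"
  have w1: "word_eval F w = ?C [^]\<^bsub>F\<^esub> N \<otimes>\<^bsub>F\<^esub> g"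
    using cancel[of u1 s v1] 1 P(1) v evP by (simp add: w_def)
  have "word_eval F (u2 @ v2) = g \<otimes>\<^bsub>F\<^esub> ?C [^]\<^bsub>F\<^esub> N"
    using cancel[of u2 t v2] 2 P(1) v evP by simp
  \<comment> \<open>Both words are reduced and have the same value, because \<open>g\<close>
    commutes with powers of \<open>c\<close>. So the first and last letters of \<open>w\<close> are
    those of \<open>c\<close>.\<close>
  then have w2: "w = u2 @ v2"
    using inj_onD[OF inj] w1 commP 1(3) 2(3) by (simp add: w_def)
  have hw: "w \<in> reduced_words X" "w \<noteq> []" "hd w = hd c"
    using 1 ne P by (auto simp: w_def)
  have lw: "last w = last c" using w2 ne P(4) 2(2) by simp
  have "c @ w \<in> reduced_words X" "w @ c \<in> reduced_words X"
    using c hw lw by (simp_all add: reduced_words_append)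
  moreover have "word_eval F (c @ w) = word_eval F (w @ c)"
  proof -
    have "?C \<otimes>\<^bsub>F\<^esub> ?C [^]\<^bsub>F\<^esub> N = ?C [^]\<^bsub>F\<^esub> N \<otimes>\<^bsub>F\<^esub> ?C"
      using F.nat_pow_Suc2[OF ev[OF c(1)], of N] by simp
    then show ?thesis
      using ev[OF c(1)] g comm by (simp add: app letters c(1) hw(1) w1 F.m_assoc[symmetric])
       (simp add: F.m_assoc)
  qed
  ultimately have "c @ w = w @ c" using inj_onD[OF inj] by blast
  \<comment> \<open>Words that commute under concatenation are powers of a common word
    \<open>z\<close>, whose value is the root.\<close>
  then obtain m n z where mn: "concat (replicate m z) = c" "concat (replicate n z) = w"
    using comm_append_are_replicate by blast
  have m: "m > 0" using mn(1) c(2) by (cases m) auto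
  then have "set z \<subseteq> set c" using mn(1) by auto
  then have z: "fst ` set z \<subseteq> carrier F" using letters[OF c(1)] by auto
  let ?r = "word_eval F z"
  have r: "?r \<in> carrier F" by (rule F.word_eval_closed[OF z])
  have cr: "?C = ?r [^]\<^bsub>F\<^esub> m" using F.word_eval_power[OF z] mn(1) by blast
  have "?r [^]\<^bsub>F\<^esub> n = ?r [^]\<^bsub>F\<^esub> (m * N) \<otimes>\<^bsub>F\<^esub> g"
    using F.word_eval_power[OF z, of n] w1 cr r unfolding mn(2) by (simp add: F.nat_pow_pow)
  then have "g = inv\<^bsub>F\<^esub> (?r [^]\<^bsub>F\<^esub> (m * N)) \<otimes>\<^bsub>F\<^esub> ?r [^]\<^bsub>F\<^esub> n"
    using r g by (simp add: F.inv_solve_left)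
  also have "\<dots> = ?r [^]\<^bsub>F\<^esub> (- int (m * N) + int n)"
    unfolding F.int_pow_mult[OF r] F.int_pow_neg[OF r] int_pow_int ..
  finally show thesis using that r m cr by blast
qed

section \<open>Separating an element from a cyclic subgroup\<close>

text \<open>Since \<open>b\<close> is nonzero, some prime has larger multiplicity in
  \<open>m\<close> than in \<open>b\<close>; \<open>e\<close> is its multiplicity in
  \<open>b\<close>.\<close>

lemma prime_power_witness:
  fixes m :: nat and b :: int
  assumes "m > 0" "\<not> int m dvd b"
  obtains p e where "prime p" "p ^ Suc e dvd m" "\<not> int (p ^ Suc e) dvd b"
proof -
  define y where "y = nat \<bar>b\<bar>"
  have y: "int d dvd b \<longleftrightarrow> d dvd y" for d by (simp add: y_def)
  have "y \<noteq> 0" using assms y[of m] by (metis dvd_0_right)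
  have "\<not> m dvd y" using assms y by blast
  then obtain p where p: "prime p" "multiplicity p y < multiplicity p m"
    using multiplicity_le_imp_dvd[of m y] assms(1) by (metis not_le not_gr_zero)
  have "p ^ Suc (multiplicity p y) dvd m" using p(2) by (intro multiplicity_dvd') simp
  moreover have "\<not> p ^ Suc (multiplicity p y) dvd y"
    using p(1) \<open>y \<noteq> 0\<close> not_prime_1 by (subst power_dvd_iff_le_multiplicity) auto
  ultimately show thesis using that p(1) y by blast
qed

text \<open>If \<open>p ^ Suc e\<close> divides the order of the image of \<open>r\<close>, then
  equal images make it divide \<open>b - int m * j\<close>. As it divides \<open>m\<close>, it would
  divide \<open>b\<close>.\<close>

lemma (in abelian_pseudovariety) separate_powers:
  assumes F: "free_on F X" and r: "r \<in> carrier F" and tf: "\<And>n::nat. n > 0 \<Longrightarrow> r [^]\<^bsub>F\<^esub> n \<noteq> \<one>\<^bsub>F\<^esub>"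
    and m: "m > 0" and b: "\<not> int m dvd b"
  shows "\<exists>H\<in>V. \<exists>h\<in>hom F H. \<forall>k::int. h (r [^]\<^bsub>F\<^esub> b) \<noteq> h ((r [^]\<^bsub>F\<^esub> m) [^]\<^bsub>F\<^esub> k)"
proof -
  interpret F: group F using F by (simp add: free_on_def)
  obtain p e where p: "prime p" "p ^ Suc e dvd m" "\<not> int (p ^ Suc e) dvd b"
    using prime_power_witness[OF m b] .
  have "r [^]\<^bsub>F\<^esub> (p ^ e) \<noteq> \<one>\<^bsub>F\<^esub>" using tf prime_gt_0_nat[OF p(1)] by simp
  then obtain H h k where H: "H \<in> V" "h \<in> hom F H" "order H = p ^ k" "h (r [^]\<^bsub>F\<^esub> (p ^ e)) \<noteq> \<one>\<^bsub>H\<^esub>"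
    using residually_p[OF p(1) F] r by (metis F.nat_pow_closed)
  interpret H: group H using pv_group[OF H(1)] by simp
  interpret h: group_hom F H h by unfold_locales (rule H(2))
  have hr: "h r \<in> carrier H" using r by simp
  have "H.ord (h r) dvd p ^ k" using H.ord_dvd_group_order[OF hr] H(3) by simp
  then obtain f where f: "H.ord (h r) = p ^ f" using divides_primepow_nat[OF p(1)] by blast
  \<comment> \<open>A power of \<open>p\<close> that does not divide \<open>p ^ e\<close> is a
    multiple of \<open>p ^ Suc e\<close>.\<close>
  have "\<not> H.ord (h r) dvd p ^ e"
    using H(4) r H.pow_eq_id[OF hr] by (simp add: h.hom_nat_pow)
  then have "Suc e \<le> f" using f le_imp_power_dvd[of f e p] by (metis not_less_eq_eq)
  then have dvd: "p ^ Suc e dvd H.ord (h r)" unfolding f by (rule le_imp_power_dvd)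
  have "h (r [^]\<^bsub>F\<^esub> b) \<noteq> h ((r [^]\<^bsub>F\<^esub> m) [^]\<^bsub>F\<^esub> j)" for j :: int
  proof
    assume eq: "h (r [^]\<^bsub>F\<^esub> b) = h ((r [^]\<^bsub>F\<^esub> m) [^]\<^bsub>F\<^esub> j)"
    have "(r [^]\<^bsub>F\<^esub> m) [^]\<^bsub>F\<^esub> j = r [^]\<^bsub>F\<^esub> (int m * j)"
      using F.int_pow_pow[OF r, of "int m" j] by (simp add: int_pow_int mult.commute)
    then have "h r [^]\<^bsub>H\<^esub> (int m * j) = h r [^]\<^bsub>H\<^esub> b"
      using eq r by (simp add: h.hom_int_pow)
    then have "int (H.ord (h r)) dvd b - int m * j" using H.int_pow_eq[OF hr] by simp
    then have "int (p ^ Suc e) dvd b - int m * j" using dvd by (meson dvd_trans of_nat_dvd_iff)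
    moreover have "int (p ^ Suc e) dvd int m * j" using p(2) by (meson dvd_mult2 of_nat_dvd_iff)
    ultimately have "int (p ^ Suc e) dvd b" by (metis diff_add_cancel dvd_add)
    then show False using p(3) by simp
  qed
  then show ?thesis using H by blast
qed

text \<open>If \<open>g\<close> commutes with the value of \<open>c\<close>, a common root reduces
  the claim to \<open>separate_powers\<close>. Otherwise their commutator survives in some quotient,
  where the image of \<open>g\<close> cannot be a power of that of \<open>c\<close>.\<close>

lemma (in abelian_pseudovariety) separate_from_cyclically_reduced:
  assumes F: "free_on F X" and g: "g \<in> carrier F"
    and c: "c \<in> reduced_words X" "c \<noteq> []" "compat (last c) (hd c)"
    and notin: "\<And>k::int. g \<noteq> word_eval F c [^]\<^bsub>F\<^esub> k"
  shows "\<exists>H\<in>V. \<exists>h\<in>hom F H. \<forall>k::int. h g \<noteq> h (word_eval F c [^]\<^bsub>F\<^esub> k)"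
proof -
  interpret F: group F using F by (simp add: free_on_def)
  let ?C = "word_eval F c"
  have X: "X \<subseteq> carrier F" and inj: "inj_on (word_eval F) (reduced_words X)"
    using F by (auto simp: free_on_def bij_betw_def)
  have letters: "fst ` set c \<subseteq> carrier F"
    using c(1) X by (auto simp: reduced_words_def)
  have C: "?C \<in> carrier F" by (rule F.word_eval_closed[OF letters])
  show ?thesis
  proof (cases "?C \<otimes>\<^bsub>F\<^esub> g = g \<otimes>\<^bsub>F\<^esub> ?C")
    case True
    obtain r and m :: nat and b :: int where r: "r \<in> carrier F" "m > 0" "?C = r [^]\<^bsub>F\<^esub> m" "g = r [^]\<^bsub>F\<^esub> b"
      using commuting_common_root[OF F c g True] .
    \<comment> \<open>Torsion of \<open>r\<close> would pass to \<open>c\<close>, but positive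
      powers of \<open>c\<close> are nonempty reduced words.\<close>
    have tf: "r [^]\<^bsub>F\<^esub> n \<noteq> \<one>\<^bsub>F\<^esub>" if "n > 0" for n :: nat
    proof
      assume "r [^]\<^bsub>F\<^esub> n = \<one>\<^bsub>F\<^esub>"
      then have "?C [^]\<^bsub>F\<^esub> n = \<one>\<^bsub>F\<^esub>"
        using r(1,3) by (metis F.nat_pow_one F.nat_pow_pow mult.commute)
      then have "word_eval F (concat (replicate n c)) = word_eval F []"
        using F.word_eval_power[OF letters] by simp
      moreover have "concat (replicate n c) \<in> reduced_words X" "concat (replicate n c) \<noteq> []"
        using cyclically_reduced_power[OF c, of n] that by auto
      moreover have "[] \<in> reduced_words X" by (simp add: reduced_words_def)
      ultimately show False using inj_onD[OF inj] by blast
    qed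
    have "\<not> int m dvd b"
    proof
      assume "int m dvd b"
      then obtain j where "b = int m * j" by blast
      then have "g = ?C [^]\<^bsub>F\<^esub> j"
        using r F.int_pow_pow[OF r(1), of "int m" j] by (simp add: int_pow_int mult.commute)
      then show False using notin by blast
    qed
    then show ?thesis
      using separate_powers[OF F r(1) tf r(2)] r(3,4) by simp
  next
    case False
    let ?z = "?C \<otimes>\<^bsub>F\<^esub> g \<otimes>\<^bsub>F\<^esub> inv\<^bsub>F\<^esub> (g \<otimes>\<^bsub>F\<^esub> ?C)"
    have "?z \<noteq> \<one>\<^bsub>F\<^esub>"
      using False C g F.inv_equality[of "?C \<otimes>\<^bsub>F\<^esub> g" "inv\<^bsub>F\<^esub> (g \<otimes>\<^bsub>F\<^esub> ?C)"]
      by (metis F.inv_closed F.inv_inv F.m_closed)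
    moreover have "?z \<in> carrier F" using C g by simp
    \<comment> \<open>Any prime serves here; 2 is a choice.\<close>
    ultimately obtain H h k where H: "H \<in> V" "h \<in> hom F H" "order H = 2 ^ k" "h ?z \<noteq> \<one>\<^bsub>H\<^esub>"
      using residually_p[OF two_is_prime_nat F] by metis
    interpret H: group H using pv_group[OF H(1)] by simp
    interpret h: group_hom F H h by unfold_locales (rule H(2))
    have "h g \<noteq> h (?C [^]\<^bsub>F\<^esub> j)" for j :: int
    proof
      assume eq: "h g = h (?C [^]\<^bsub>F\<^esub> j)"
      have "?C \<otimes>\<^bsub>F\<^esub> ?C [^]\<^bsub>F\<^esub> j = ?C [^]\<^bsub>F\<^esub> j \<otimes>\<^bsub>F\<^esub> ?C"
        using F.int_pow_mult[OF C, of 1 j] F.int_pow_mult[OF C, of j 1] C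
        by (simp add: add.commute)
      then have "h ?C \<otimes>\<^bsub>H\<^esub> h g = h g \<otimes>\<^bsub>H\<^esub> h ?C"
        unfolding eq using C by (metis F.int_pow_closed h.hom_mult)
      then show False using H(4) C g by simp
    qed
    then show ?thesis using H by blast
  qed
qed

text \<open>If \<open>c\<close> is not cyclically reduced, its last letter is inverse to its first,
  and conjugation replaces \<open>c\<close> by the shorter inner word. As \<open>g\<close> is
  conjugated too, the induction varies it.\<close>

lemma (in abelian_pseudovariety) separate_from_cyclic:
  assumes F: "free_on F X"
  shows "c \<in> reduced_words X \<Longrightarrow> g \<in> carrier F \<Longrightarrow> (\<And>k::int. g \<noteq> word_eval F c [^]\<^bsub>F\<^esub> k) \<Longrightarrow>
    \<exists>H\<in>V. \<exists>h\<in>hom F H. \<forall>k::int. h g \<noteq> h (word_eval F c [^]\<^bsub>F\<^esub> k)"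
proof (induction "length c" arbitrary: c g rule: less_induct)
  case less
  interpret F: group F using F by (simp add: free_on_def)
  have X: "X \<subseteq> carrier F" using F by (simp add: free_on_def)
  consider "c = []" | "c \<noteq> []" "compat (last c) (hd c)" | "c \<noteq> []" "\<not> compat (last c) (hd c)" by blast
  then show ?case
  proof cases
    case 1
    then have c1: "word_eval F c [^]\<^bsub>F\<^esub> k = \<one>\<^bsub>F\<^esub>" for k :: int by simp
    then have "g \<noteq> \<one>\<^bsub>F\<^esub>" using less.prems(3) by metis
    then obtain H h k where H: "H \<in> V" "h \<in> hom F H" "order H = 2 ^ k" "h g \<noteq> \<one>\<^bsub>H\<^esub>"
      using residually_p[OF two_is_prime_nat F less.prems(2)] by metis
    interpret H: group H using pv_group[OF H(1)] by simp
    interpret h: group_hom F H h by unfold_locales (rule H(2))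
    have "\<forall>k::int. h g \<noteq> h (word_eval F c [^]\<^bsub>F\<^esub> k)" using H(4) unfolding c1 by simp
    then show ?thesis using H by blast
  next
    case 2
    then show ?thesis
      using separate_from_cyclically_reduced[OF F less.prems(2,1)] less.prems(3) by blast
  next
    case 3
    obtain p c' where c': "c = p # c'" using 3 by (cases c) auto
    with 3 have "c' \<noteq> []" by auto
    then obtain d q where d: "c = p # d @ [q]" using c' by (cases c' rule: rev_cases) auto
    with 3 have q: "q = (fst p, \<not> snd p)" by (auto simp: prod_eq_iff)
    have dr: "d \<in> reduced_words X"
      using less.prems(1) reduced_words_append[of "[p]" "d @ [q]"] by (simp add: d reduced_words_append)
    have p: "fst p \<in> carrier F" using less.prems(1) X d by (auto simp: reduced_words_def)
    define y where "y = word_eval F [p]"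
    have y: "y \<in> carrier F" using p by (simp add: y_def)
    let ?D = "word_eval F d"
    have dl: "fst ` set d \<subseteq> carrier F" using dr X by (auto simp: reduced_words_def)
    have D: "?D \<in> carrier F" by (rule F.word_eval_closed[OF dl])
    have cy: "word_eval F c = y \<otimes>\<^bsub>F\<^esub> ?D \<otimes>\<^bsub>F\<^esub> inv\<^bsub>F\<^esub> y"
      using p D dl by (simp add: d y_def q word_eval_append[OF F.is_group] F.m_assoc)
    have pow: "word_eval F c [^]\<^bsub>F\<^esub> k = y \<otimes>\<^bsub>F\<^esub> ?D [^]\<^bsub>F\<^esub> k \<otimes>\<^bsub>F\<^esub> inv\<^bsub>F\<^esub> y" for k :: int
      unfolding cy by (rule F.int_pow_conjugate[OF D y])
    define g' where "g' = inv\<^bsub>F\<^esub> y \<otimes>\<^bsub>F\<^esub> g \<otimes>\<^bsub>F\<^esub> y"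
    have g': "g' \<in> carrier F" using y less.prems(2) by (simp add: g'_def)
    have gg': "g = y \<otimes>\<^bsub>F\<^esub> g' \<otimes>\<^bsub>F\<^esub> inv\<^bsub>F\<^esub> y"
    proof -
      have "y \<otimes>\<^bsub>F\<^esub> (inv\<^bsub>F\<^esub> y \<otimes>\<^bsub>F\<^esub> g) = g"
        using y less.prems(2) by (simp add: F.m_assoc[symmetric])
      then show ?thesis using y less.prems(2) by (simp add: g'_def F.m_assoc)
    qed
    have "g' \<noteq> ?D [^]\<^bsub>F\<^esub> k" for k :: int
      using less.prems(3)[of k] gg' pow by metis
    then obtain H h where H: "H \<in> V" "h \<in> hom F H" and sep: "\<forall>k::int. h g' \<noteq> h (?D [^]\<^bsub>F\<^esub> k)"
      using less.hyps[OF _ dr g'] d by auto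
    interpret H: group H using pv_group[OF H(1)] by simp
    interpret h: group_hom F H h by unfold_locales (rule H(2))
    have "h g \<noteq> h (word_eval F c [^]\<^bsub>F\<^esub> k)" for k :: int
    proof -
      have "h g' \<noteq> h (?D [^]\<^bsub>F\<^esub> k)" using sep by blast
      then show ?thesis
        unfolding pow using y g' D by (subst gg') (simp add: H.right_cancel)
    qed
    then show ?thesis using H by blast
  qed
qed

text \<open>A homomorphism that separates \<open>g\<close> from \<open>C\<close> gives an open
  neighbourhood of \<open>g\<close> disjoint from \<open>C\<close>: the elements whose image lies
  outside the image of \<open>C\<close>.\<close>

lemma (in abelian_pseudovariety) cyclic_subgroup_closed:
  assumes F: "free_on F X" and C: "subgroup C F" "cyclic_group (F\<lparr>carrier := C\<rparr>)"
  shows "closedin (pro_topology V F) C"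
proof -
  interpret F: group F using F by (simp add: free_on_def)
  interpret C: group "F\<lparr>carrier := C\<rparr>" by (rule F.subgroup_imp_group[OF C(1)])
  have top: "topspace (pro_topology V F) = carrier F"
    by (rule topspace_pro_topology[OF pseudovariety F.is_group])
  obtain x where x: "x \<in> C" "C = range (\<lambda>n::int. x [^]\<^bsub>F\<lparr>carrier := C\<rparr>\<^esub> n)"
    using C(2) C.cyclic_group by auto
  have CF: "C \<subseteq> carrier F" using C(1) by (rule subgroup.subset)
  have Cx: "C = range (\<lambda>n::int. x [^]\<^bsub>F\<^esub> n)"
    using x(2) F.int_pow_consistent[OF C(1) x(1)] by simp
  obtain c where c: "c \<in> reduced_words X" "word_eval F c = x"
    using free_on_word[OF F] x(1) CF by blast
  have "openin (pro_topology V F) (carrier F - C)"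
  proof (subst openin_subopen, intro ballI)
    fix g assume g: "g \<in> carrier F - C"
    then have "g \<noteq> word_eval F c [^]\<^bsub>F\<^esub> k" for k :: int using Cx c(2) by auto
    then obtain H h where H: "H \<in> V" "h \<in> hom F H" and sep: "\<forall>k::int. h g \<noteq> h (x [^]\<^bsub>F\<^esub> k)"
      using separate_from_cyclic[OF F c(1), of g] g c(2) by auto
    let ?U = "{y \<in> carrier F. h y \<in> carrier H - h ` C}"
    have "openin (pro_topology V F) ?U"
      unfolding pro_topology_def using H
      by (intro topology_generated_by_Basis CollectI exI[of _ h] exI[of _ H]
          exI[of _ "carrier H - h ` C"]) auto
    moreover have "g \<in> ?U" using g H(2) sep Cx by (auto simp: hom_def)
    moreover have "?U \<subseteq> carrier F - C" by auto
    ultimately show "\<exists>T. openin (pro_topology V F) T \<and> g \<in> T \<and> T \<subseteq> carrier F - C" by blast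
  qed
  then show ?thesis unfolding closedin_def top using CF by simp
qed

section \<open>The infinite cyclic group as a free group\<close>

text \<open>Neighbouring letters of a reduced word over one generator have the same sign, so these
  words are constant and correspond to the integers.\<close>

lemma infinite_cyclic_free:
  assumes "group F" "x \<in> carrier F" "bij_betw (\<lambda>k::int. x [^]\<^bsub>F\<^esub> k) UNIV (carrier F)"
  shows "free_on F {x}"
proof -
  interpret group F by fact
  define w where "w k = replicate (nat \<bar>k\<bar>) (x, k \<ge> 0)" for k :: int
  have eval: "word_eval F (replicate n (x, b)) = (if b then x [^]\<^bsub>F\<^esub> n else inv\<^bsub>F\<^esub> x [^]\<^bsub>F\<^esub> n)" for n b
  proof (induction n)
    case (Suc n)
    then show ?case using nat_pow_Suc2[of x n] nat_pow_Suc2[of "inv\<^bsub>F\<^esub> x" n] assms(2)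
      by (simp del: nat_pow_Suc)
  qed simp
  have "w k \<in> reduced_words {x}" for k
    by (auto simp: w_def reduced_words_def successively_conv_nth)
  moreover have "inj w"
  proof (rule injI)
    fix k l assume eq: "w k = w l"
    then have "\<bar>k\<bar> = \<bar>l\<bar>" using arg_cong[OF eq, of length] unfolding w_def length_replicate by linarith
    \<comment> \<open>Only a nonempty word shows its sign, hence the separate case
      \<open>k = 0\<close>.\<close>
    then show "k = l" using eq by (cases "k = 0") (auto simp: w_def abs_if split: if_splits)
  qed
  moreover have "\<exists>k. v = w k" if v: "v \<in> reduced_words {x}" for v
  proof (cases v)
    case Nil
    then show ?thesis by (intro exI[of _ 0]) (simp add: w_def)
  next
    case (Cons a v')
    have same: "v ! i = hd v" if "i < length v" for i
      using that
    proof (induction i)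
      case 0
      then show ?case by (simp add: Cons)
    next
      case (Suc i)
      have "fst (v ! j) = x" if "j < length v" for j
        using v nth_mem[OF that] by (auto simp: reduced_words_def image_subset_iff)
      from this[of i] this[of "Suc i"] have "fst (v ! i) = fst (v ! Suc i)"
        using Suc.prems by simp
      then show ?case using reduced_words_adjacent[OF v Suc.prems] Suc by (simp add: prod_eq_iff)
    qed
    have pos: "length v > 0" using Cons by simp
    have "v = replicate (length v) (hd v)" by (rule nth_equalityI) (auto simp: same)
    moreover have "fst (hd v) = x" using v Cons by (auto simp: reduced_words_def)
    then have "hd v = (x, snd (hd v))" by (auto simp: prod_eq_iff)
    ultimately have "v = replicate (length v) (x, snd (hd v))" by metis
    also have "\<dots> = w (if snd (hd v) then int (length v) else - int (length v))"
      using pos by (simp add: w_def)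
    finally show ?thesis by blast
  qed
  ultimately have "bij_betw w UNIV (reduced_words {x})"
    unfolding bij_betw_def by blast
  moreover have "word_eval F (w k) = x [^]\<^bsub>F\<^esub> k" for k
    unfolding w_def eval int_pow_def2 using nat_pow_inv[OF assms(2)] by (cases "k < 0") simp_all
  then have "bij_betw (word_eval F \<circ> w) UNIV (carrier F)"
    using assms(3) by (simp add: comp_def)
  ultimately have "bij_betw (word_eval F) (reduced_words {x}) (carrier F)"
    using bij_betw_comp_iff by blast
  then show ?thesis using assms by (simp add: free_on_def)
qed

text \<open>The integers embed into every infinite type, so a free group of rank one is available
  over the type of the theorem.\<close>

lemma infinite_cyclic_group_exists:
  assumes "infinite (UNIV :: 'a set)"
  obtains F :: "'a monoid" and x where "group F" "x \<in> carrier F"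
    "bij_betw (\<lambda>k::int. x [^]\<^bsub>F\<^esub> k) UNIV (carrier F)"
proof -
  obtain f0 :: "nat \<Rightarrow> 'a" where "inj f0" using infinite_countable_subset[OF assms] by blast
  define f where "f = f0 \<circ> int_encode"
  define F where "F = image_group f integer_group"
  have inj_f: "inj_on f (carrier integer_group)"
    using \<open>inj f0\<close> by (simp add: f_def inj_compose inj_int_encode)
  have F: "group F" unfolding F_def
    by (rule group.inj_imp_image_group_is_group[OF group_integer_group inj_f])
  have iso: "f \<in> iso integer_group F" unfolding F_def by (rule inj_imp_image_group_iso[OF inj_f])
  interpret F: group F by fact
  interpret f: group_hom integer_group F f
    using iso by (intro group_hom.intro group_hom_axioms.intro) (auto simp: iso_def F)
  have "f 1 [^]\<^bsub>F\<^esub> k = f k" for k :: int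
    using f.hom_int_pow[of 1 k] by simp
  then have "bij_betw (\<lambda>k::int. f 1 [^]\<^bsub>F\<^esub> k) UNIV (carrier F)"
    using iso by (simp add: iso_def)
  moreover have "f 1 \<in> carrier F" by (rule f.hom_closed) simp
  ultimately show thesis using that[OF F] by blast
qed

section \<open>The closure of the subgroup generated by a \<open>p\<close>-th power\<close>

text \<open>If no group in \<open>V\<close> has order divisible by \<open>p\<close>, then every neighbourhood of \<open>y\<close> contains a coset
  \<open>y \<langle>x\<^sup>m\<rangle>\<close> with \<open>m\<close> prime to \<open>p\<close>. So \<open>x\<close> is in the closure of \<open>\<langle>x\<^sup>p\<rangle>\<close>.\<close>

lemma pro_topology_coset_neighbourhood:
  fixes V :: "nat monoid set" and p :: nat
  assumes V: "\<And>H. H \<in> V \<Longrightarrow> group H \<and> finite (carrier H)"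
    and p: "prime p" "\<And>H. H \<in> V \<Longrightarrow> \<not> p dvd order H"
    and F: "group F" and x: "x \<in> carrier F"
    and U: "openin (pro_topology V F) U" and y: "y \<in> U"
  shows "\<exists>m. coprime m p \<and> (\<forall>k::int. y \<otimes>\<^bsub>F\<^esub> x [^]\<^bsub>F\<^esub> (int m * k) \<in> U)"
proof -
  interpret F: group F by fact
  have "generate_topology_on
      {{x \<in> carrier F. h x \<in> U} | h H U. H \<in> V \<and> h \<in> hom F H \<and> U \<subseteq> carrier H} U"
    using U unfolding pro_topology_def openin_topology_generated_by_iff .
  then show ?thesis using y
  proof (induction arbitrary: y)
    \<comment> \<open>The product \<open>m * n\<close> is still prime to \<open>p\<close>, and its
      multiples are multiples of both \<open>m\<close> and \<open>n\<close>.\<close>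
    case (Int a b)
    then obtain m n where "coprime m p" "\<And>k::int. y \<otimes>\<^bsub>F\<^esub> x [^]\<^bsub>F\<^esub> (int m * k) \<in> a"
      "coprime n p" "\<And>k::int. y \<otimes>\<^bsub>F\<^esub> x [^]\<^bsub>F\<^esub> (int n * k) \<in> b" by blast
    moreover from this(2)[of "int n * _"] this(4)[of "int m * _"]
    have "y \<otimes>\<^bsub>F\<^esub> x [^]\<^bsub>F\<^esub> (int (m * n) * k) \<in> a \<inter> b" for k :: int
      by (simp add: mult.assoc mult.left_commute)
    ultimately show ?case by (intro exI[of _ "m * n"]) simp
  next
    case (UN K)
    then show ?case by (meson UnionE UnionI)
  next
    case (Basis s)
    then obtain h H U where s: "s = {x \<in> carrier F. h x \<in> U}" "H \<in> V" "h \<in> hom F H" by blast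
    interpret H: group H using V[OF s(2)] by simp
    interpret h: group_hom F H h by unfold_locales (rule s(3))
    have y: "y \<in> carrier F" "h y \<in> U" using Basis.prems s(1) by auto
    \<comment> \<open>The order of \<open>H\<close> serves as \<open>m\<close>: it kills the image
      of \<open>x\<close> and is prime to \<open>p\<close>.\<close>
    have "h (y \<otimes>\<^bsub>F\<^esub> x [^]\<^bsub>F\<^esub> (int (order H) * k)) = h y" for k :: int
    proof -
      have "int (H.ord (h x)) dvd int (order H) * k"
        using H.ord_dvd_group_order[of "h x"] x by (simp add: dvd_mult2)
      then have "h x [^]\<^bsub>H\<^esub> (int (order H) * k) = \<one>\<^bsub>H\<^esub>"
        using H.int_pow_eq_id[of "h x"] x by simp
      then show ?thesis using x y by (simp add: h.hom_int_pow)
    qed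
    moreover have "coprime (order H) p"
      using p(2)[OF s(2)] prime_imp_coprime[OF p(1)] coprime_commute by blast
    ultimately show ?case using y x unfolding s(1) by (intro exI[of _ "order H"]) simp
  qed auto
qed

text \<open>Otherwise the complement of the subgroup is a neighbourhood of \<open>x\<close>, so it
  contains a coset of the powers of \<open>x\<close> with exponent divisible by some
  \<open>m\<close> prime to \<open>p\<close>. This coset meets the subgroup.\<close>

lemma (in extension_closed_pseudovariety) closed_power_imp_dvd_order:
  fixes p :: nat
  assumes F: "group F" and x: "x \<in> carrier F" "inj (\<lambda>k::int. x [^]\<^bsub>F\<^esub> k)"
    and p: "prime p" and closed: "closedin (pro_topology V F) (generate F {x [^]\<^bsub>F\<^esub> p})"
  shows "\<exists>H\<in>V. p dvd order H"
proof (rule ccontr)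
  assume contra: "\<not> ?thesis"
  interpret F: group F by fact
  let ?C = "generate F {x [^]\<^bsub>F\<^esub> p}"
  have C: "?C = range (\<lambda>k::int. x [^]\<^bsub>F\<^esub> (int p * k))"
  proof -
    have "(x [^]\<^bsub>F\<^esub> p) [^]\<^bsub>F\<^esub> k = x [^]\<^bsub>F\<^esub> (int p * k)" for k :: int
      using F.int_pow_pow[OF x(1), of "int p" k] by (simp add: int_pow_int mult.commute)
    then show ?thesis using F.generate_pow[of "x [^]\<^bsub>F\<^esub> p"] x(1) by auto
  qed
  have "x \<notin> ?C"
  proof
    assume "x \<in> ?C"
    then obtain k :: int where "x [^]\<^bsub>F\<^esub> (1::int) = x [^]\<^bsub>F\<^esub> (int p * k)" using C x(1) by auto
    then have "1 = int p * k" using injD[OF x(2)] by blast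
    then have "int p dvd 1" by (metis dvd_triv_left)
    then show False using p by (simp add: prime_nat_iff)
  qed
  moreover have "openin (pro_topology V F) (carrier F - ?C)"
    using closed topspace_pro_topology[OF pseudovariety F] by (simp add: closedin_def)
  ultimately obtain m where m: "coprime m p"
    "\<And>k::int. x \<otimes>\<^bsub>F\<^esub> x [^]\<^bsub>F\<^esub> (int m * k) \<in> carrier F - ?C"
    using pro_topology_coset_neighbourhood[OF pv_group p _ F x(1)] contra x(1) by blast
  obtain u v where "u * int m + v * int p = 1"
    using bezout_int[of "int m" "int p"] m(1) by (auto simp: coprime_iff_gcd_eq_1)
  \<comment> \<open>The choice \<open>k = - u\<close> gives an element of the coset whose exponent
    is a multiple of \<open>p\<close>.\<close>
  then have uv: "1 + int m * (- u) = int p * v" by (simp add: algebra_simps)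
  have "x \<otimes>\<^bsub>F\<^esub> x [^]\<^bsub>F\<^esub> (int m * (- u)) = x [^]\<^bsub>F\<^esub> (int p * v)"
    unfolding uv[symmetric] using F.int_pow_mult[OF x(1), of 1 "int m * (- u)"] x(1) by simp
  then show False using m(2)[of "- u"] C by auto
qed

section \<open>Closed cyclic subgroups versus finite abelian members\<close>

theorem corollary3p3:
  fixes V :: "nat monoid set"
  assumes "pseudovariety V"
    and "extension_closed V"
    and "infinite (UNIV :: 'a set)"
  shows "(\<forall>F :: 'a monoid. free_group F \<longrightarrow>
            (\<forall>C. subgroup C F \<and> cyclic_group (F\<lparr>carrier := C\<rparr>) \<longrightarrow> closedin (pro_topology V F) C))
     \<longleftrightarrow> (\<forall>A :: nat monoid. comm_group A \<and> finite (carrier A) \<longrightarrow> A \<in> V)"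
proof (intro iffI allI impI)
  interpret extension_closed_pseudovariety V using assms by unfold_locales
  fix A :: "nat monoid"
  assume closed: "\<forall>F :: 'a monoid. free_group F \<longrightarrow>
    (\<forall>C. subgroup C F \<and> cyclic_group (F\<lparr>carrier := C\<rparr>) \<longrightarrow> closedin (pro_topology V F) C)"
  assume A: "comm_group A \<and> finite (carrier A)"
  obtain F :: "'a monoid" and x where F: "group F" "x \<in> carrier F"
    and bij: "bij_betw (\<lambda>k::int. x [^]\<^bsub>F\<^esub> k) UNIV (carrier F)"
    using infinite_cyclic_group_exists[OF assms(3)] .
  interpret F: group F by fact
  have free: "free_group F"
    unfolding free_group_def using infinite_cyclic_free[OF F bij] by blast
  \<comment> \<open>The test subgroup for the prime \<open>p\<close> is generated by the
    \<open>p\<close>-th power of the free generator \<open>x\<close>.\<close>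
  have primes: "\<exists>H\<in>V. p dvd order H" if "prime p" for p :: nat
  proof (rule closed_power_imp_dvd_order[OF F _ that])
    show "inj (\<lambda>k::int. x [^]\<^bsub>F\<^esub> k)" using bij by (simp add: bij_betw_def)
    have xp: "x [^]\<^bsub>F\<^esub> p \<in> carrier F" using F(2) by simp
    have "cyclic_group (F\<lparr>carrier := generate F {x [^]\<^bsub>F\<^esub> p}\<rparr>)"
      using F.cyclic_group_generated[of "x [^]\<^bsub>F\<^esub> p"] xp by (simp add: subgroup_generated_def)
    moreover have "subgroup (generate F {x [^]\<^bsub>F\<^esub> p}) F"
      using xp by (intro F.generate_is_subgroup) auto
    ultimately show "closedin (pro_topology V F) (generate F {x [^]\<^bsub>F\<^esub> p})"
      using closed free by blast
  qed
  then have "V \<noteq> {}" using two_is_prime_nat by blast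
  with primes show "A \<in> V" using finite_abelian_in_class A by blast
next
  fix F :: "'a monoid" and C
  assume "\<forall>A :: nat monoid. comm_group A \<and> finite (carrier A) \<longrightarrow> A \<in> V"
  then interpret abelian_pseudovariety V using assms by unfold_locales auto
  assume "free_group F" and "subgroup C F \<and> cyclic_group (F\<lparr>carrier := C\<rparr>)"
  then show "closedin (pro_topology V F) C"
    using cyclic_subgroup_closed unfolding free_group_def by blast
qed

end
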